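(* Suppose that $P_n$ is an irreducible polynomial with integer coefficients, of degree at most $n$, with $P_n(0)\neq 0$ and with all zeros in the closed unit disk $\{z\in\mathbb{C}:|z|\le 1\}$. Then $P_n$ is cyclotomic if and only if $\|P_n\|_0=1$.
   Context: For a nonzero polynomial $P$ with complex coefficients, $$\|P\|_0 := \exp\left(\frac{1}{\pi}\iint_{\mathbb{D}}\log|P(z)|\,dA\right),$$ where $\mathbb{D}=\{z\in\mathbb{C}:|z|<1\}$ is the open unit disk and $dA$ is the area (Lebesgue) measure. A cyclotomic polynomial is defined as an irreducible factor of $z^m-1$ for some $m\in\mathbb{N}$. Irreducibility and factors are understood in $\mathbb{Z}[z]$; in particular cyclotomic polynomials are determined up to sign. *)

theory Defs
  imports
    "HOL-Analysis.Analysis"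
    "HOL-Computational_Algebra.Computational_Algebra"
begin

(* Only meaningful for P \<noteq> 0. The value ln 0 = 0 at the finitely many zeros of P
   in place of minus infinity is harmless, since these form a null set. *)
definition norm0 :: "complex poly \<Rightarrow> real" where
  "norm0 P = exp (1 / pi * (LINT z:ball 0 1|lborel. ln (cmod (poly P z))))"

(* m = 0 has to be excluded, because every polynomial divides z ^ 0 - 1 = 0. *)
definition cyclotomic_poly :: "int poly \<Rightarrow> bool" where
  "cyclotomic_poly P \<longleftrightarrow> irreducible P \<and> (\<exists>m::nat. m \<ge> 1 \<and> P dvd monom 1 m - 1)"

end

theory Submission
  imports Defs "HOL-Real_Asymp.Real_Asymp"
begin

text \<open>
  For \<open>|a| = 1\<close> the mean of \<open>ln |z - a|\<close> over the unit disk is \<open>0\<close>, and for \<open>0 < |a| < 1\<close> it is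
  strictly larger than \<open>ln |a|\<close>. If \<open>P\<close> has leading coefficient \<open>c\<close> and zeros \<open>a\<^sub>j\<close>, then
  \<open>ln \<parallel>P\<parallel>\<^sub>0\<close> is \<open>ln |c|\<close> plus the sum of these means, whereas
  \<open>ln |c| + \<Sum> ln |a\<^sub>j| = ln |P(0)| \<ge> 0\<close>. So \<open>\<parallel>P\<parallel>\<^sub>0 = 1\<close> forces all \<open>|a\<^sub>j| = 1\<close> and
  \<open>|c| = 1\<close>, and Kronecker's theorem applies.

  The means are computed without polar coordinates: if \<open>h\<close> is \<open>z / a\<close> or \<open>a / z\<close> on a rotation-invariant
  set where \<open>|h| \<le> q < 1\<close>, a rotation that changes the sign of \<open>h\<^sup>m\<close> shows
  \<open>2 \<integral> ln |1 - h\<^sup>m| = \<integral> ln |1 - h\<^sup>2\<^sup>m|\<close>; iterating, \<open>\<integral> ln |1 - h|\<close> is at most a constant times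
  \<open>2\<^sup>-\<^sup>k\<close> for every \<open>k\<close>.
\<close>


subsection \<open>Irreducible integer polynomials and Kronecker's theorem\<close>

abbreviation cpoly :: "int poly \<Rightarrow> complex poly" where
  "cpoly \<equiv> map_poly of_int"

lemma cpoly_mult: "cpoly (p * q) = cpoly p * cpoly q"
  by (rule poly_eqI) (simp add: coeff_map_poly coeff_mult)

lemma cpoly_add: "cpoly (p + q) = cpoly p + cpoly q"
  by (rule poly_eqI) (simp add: coeff_map_poly)

lemma cpoly_diff: "cpoly (p - q) = cpoly p - cpoly q"
  by (rule poly_eqI) (simp add: coeff_map_poly)

lemma degree_cpoly: "degree (cpoly p) = degree p"
  by (rule degree_map_poly) auto

text \<open>Everything stays in Z[x]: irreducible elements are prime there, so \<open>P\<close> can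
  be compared with a minimal-degree polynomial \<open>M\<close> at \<open>\<alpha>\<close> and the
  constant factors from pseudo-division can be stripped afterwards.\<close>

lemma irreducible_dvd_of_common_root:
  fixes P Q :: "int poly" and \<alpha> :: complex
  assumes irr: "irreducible P" and P\<alpha>: "poly (cpoly P) \<alpha> = 0" and Q\<alpha>: "poly (cpoly Q) \<alpha> = 0"
  shows "P dvd Q"
proof -
  have prime: "prime_elem P" and P0: "P \<noteq> 0"
    using irr by (auto simp: prime_elem_iff_irreducible)
  have const: "\<not> P dvd [:c:]" if "c \<noteq> 0" for c
  proof
    assume "P dvd [:c:]"
    then obtain R where R: "[:c:] = P * R" ..
    have "poly (cpoly [:c:]) \<alpha> = 0" unfolding R cpoly_mult by (simp add: P\<alpha>)
    with that show False by (simp add: map_poly_pCons)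
  qed
  \<comment> \<open>\<open>M\<close> will be a nonzero integer polynomial of minimal degree that vanishes at \<open>\<alpha>\<close>; it divides
    every other one up to a constant factor.\<close>
  define V where "V M \<longleftrightarrow> M \<noteq> 0 \<and> poly (cpoly M) \<alpha> = 0" for M
  obtain M where M: "V M" "\<And>N. V N \<Longrightarrow> degree M \<le> degree N"
    using ex_has_least_nat[of V P degree] P0 P\<alpha> by (auto simp: V_def)
  have pd: "\<exists>c R. c \<noteq> 0 \<and> smult c N = M * R" if N: "poly (cpoly N) \<alpha> = 0" for N
  proof -
    \<comment> \<open>The pseudo-remainder vanishes at \<open>\<alpha>\<close> and would have
      smaller degree than \<open>M\<close>, so minimality makes it zero.\<close>
    obtain q r where qr: "pseudo_divmod N M = (q, r)" by fastforce
    let ?c = "lead_coeff M ^ (Suc (degree N) - degree M)"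
    have eq: "smult ?c N = M * q + r" and r: "r = 0 \<or> degree r < degree M"
      using pseudo_divmod[OF _ qr] M by (auto simp: V_def)
    have "r = smult ?c N - M * q" using eq by simp
    hence "poly (cpoly r) \<alpha> = 0"
      using N M by (simp add: cpoly_diff cpoly_mult V_def map_poly_smult)
    hence "r = 0" using r M(2)[of r] by (metis V_def linorder_not_le)
    thus ?thesis using eq M by (intro exI[of _ ?c] exI[of _ q]) (auto simp: V_def)
  qed
  obtain c R where cR: "c \<noteq> 0" "smult c P = M * R" using pd[OF P\<alpha>] by blast
  have "P dvd M * R" unfolding cR(2)[symmetric] by (simp add: dvd_smult)
  hence "P dvd M \<or> P dvd R" using prime prime_elem_dvd_multD by blast
  \<comment> \<open>Cancelling \<open>P\<close> would leave \<open>M\<close> as a divisor of a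
    nonzero constant, which cannot vanish at \<open>\<alpha>\<close>.\<close>
  moreover have "\<not> P dvd R"
  proof
    assume "P dvd R"
    then obtain S where S: "R = P * S" ..
    have "P * [:c:] = P * (M * S)" using cR S by (simp add: algebra_simps)
    hence "[:c:] = M * S" using P0 mult_left_cancel by blast
    hence "poly (cpoly [:c:]) \<alpha> = 0" using M by (simp add: cpoly_mult V_def)
    with cR show False by (simp add: map_poly_pCons)
  qed
  ultimately have "P dvd M" by blast
  \<comment> \<open>Primality removes the constant: \<open>P\<close> divides \<open>c\<close> times
    \<open>Q\<close> but not \<open>c\<close>.\<close>
  obtain c R where cR: "c \<noteq> 0" "smult c Q = M * R" using pd[OF Q\<alpha>] by blast
  have "P dvd [:c:] * Q" using cR \<open>P dvd M\<close> by simp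
  thus "P dvd Q" using prime const[OF cR(1)] prime_elem_dvd_multD by blast
qed

text \<open>A double root is a common root of \<open>P\<close> and its derivative, so
  \<open>P\<close> would divide a polynomial of smaller degree. Then the derivative is zero and
  \<open>P\<close> is a constant with a root.\<close>

lemma rsquarefree_cpoly:
  assumes "irreducible P"
  shows "rsquarefree (cpoly P)"
  unfolding rsquarefree_roots
proof (intro allI notI)
  fix a assume a: "poly (cpoly P) a = 0 \<and> poly (pderiv (cpoly P)) a = 0"
  have "pderiv (cpoly P) = cpoly (pderiv P)"
    by (rule poly_eqI) (simp add: coeff_map_poly coeff_pderiv)
  hence "P dvd pderiv P" using a assms irreducible_dvd_of_common_root by metis
  hence "degree P = 0"
    using dvd_imp_degree_le[of P "pderiv P"] by (cases "pderiv P = 0") (auto simp: degree_pderiv pderiv_eq_0_iff)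
  then obtain c where "P = [:c:]" by (rule degree_eq_zeroE)
  with a have "P = 0" by (simp add: map_poly_pCons)
  with assms show False by simp
qed

lemma card_roots_cpoly:
  assumes "irreducible P"
  shows "card {z. poly (cpoly P) z = 0} = degree P"
proof -
  have "degree (smult (lead_coeff (cpoly P)) (\<Prod>z|poly (cpoly P) z = 0. [:-z, 1:])) = degree P"
    by (subst complex_poly_decompose_rsquarefree[OF rsquarefree_cpoly[OF assms]]) (rule degree_cpoly)
  moreover have "cpoly P \<noteq> 0" using rsquarefree_cpoly[OF assms] by (auto simp: rsquarefree_def)
  ultimately show ?thesis by (simp add: degree_prod_eq_sum_degree)
qed

text \<open>Lagrange interpolation: a polynomial of degree below \<open>card A\<close> is the
  combination of the basis polynomials \<open>L a\<close> weighted by its values on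
  \<open>A\<close>, so bounded values give bounded coefficients.\<close>

lemma coeff_bound_of_values:
  fixes A :: "complex set"
  assumes "finite A"
  obtains B :: real where
    "\<And>r i. degree r < card A \<Longrightarrow> (\<And>a. a \<in> A \<Longrightarrow> cmod (poly r a) \<le> 1) \<Longrightarrow> cmod (coeff r i) \<le> B"
proof -
  define L where "L a = (\<Prod>b\<in>A-{a}. smult (1 / (a - b)) [:-b, 1:])" for a
  have L: "poly (L a) c = (if a = c then 1 else 0)" if "a \<in> A" "c \<in> A" for a c
  proof -
    have "poly (L a) c = (\<Prod>b\<in>A-{a}. (c - b) / (a - b))"
      by (simp add: L_def poly_prod diff_divide_distrib)
    thus ?thesis using that assms by (auto intro!: prod.neutral)
  qed
  have degL: "degree (L a) < card A" if "a \<in> A" for a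
  proof -
    have "degree (L a) \<le> (\<Sum>b\<in>A-{a}. degree (smult (1 / (a - b)) [:-b, 1:]))"
      unfolding L_def using assms
      by (intro order.trans[OF degree_prod_sum_le]) (simp_all only: o_def finite_Diff order.refl)
    also have "\<dots> \<le> (\<Sum>b\<in>A-{a}. 1)" by (intro sum_mono) simp
    also have "\<dots> < card A" using that assms card_gt_0_iff[of A] by auto
    finally show ?thesis .
  qed
  show thesis
  proof (rule that)
    fix r i assume deg: "degree r < card A" and r: "\<And>a. a \<in> A \<Longrightarrow> cmod (poly r a) \<le> 1"
    have "r = (\<Sum>a\<in>A. smult (poly r a) (L a))"
    proof (rule poly_eqI_degree[of A])
      fix x assume "x \<in> A"
      thus "poly r x = poly (\<Sum>a\<in>A. smult (poly r a) (L a)) x"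
        using assms by (simp add: poly_sum L if_distrib cong: if_cong)
    next
      have "A \<noteq> {}" using deg by auto
      have "degree (\<Sum>a\<in>A. smult (poly r a) (L a)) \<le> card A - 1"
        by (rule degree_sum_le) (use assms degL in \<open>auto simp: Suc_le_eq intro!: order.trans[OF degree_smult_le] dest!: degL\<close>)
      thus "degree (\<Sum>a\<in>A. smult (poly r a) (L a)) < card A" using deg by linarith
    qed (fact deg)
    hence "coeff r i = (\<Sum>a\<in>A. poly r a * coeff (L a) i)"
      by (metis (no_types, lifting) coeff_smult coeff_sum sum.cong)
    hence "cmod (coeff r i) \<le> (\<Sum>a\<in>A. cmod (poly r a) * cmod (coeff (L a) i))"
      by (metis (no_types, lifting) norm_mult norm_sum sum.cong)
    \<comment> \<open>Summing over all coefficients of \<open>L a\<close> makes the bound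
      independent of \<open>i\<close>.\<close>
    also have "\<dots> \<le> (\<Sum>a\<in>A. 1 * (\<Sum>j\<le>card A. cmod (coeff (L a) j)))"
    proof (intro sum_mono mult_mono r)
      fix a assume "a \<in> A"
      show "cmod (coeff (L a) i) \<le> (\<Sum>j\<le>card A. cmod (coeff (L a) j))"
      proof (cases "i \<le> card A")
        case True thus ?thesis by (intro member_le_sum) auto
      next
        case False 
        hence "coeff (L a) i = 0" using degL[OF \<open>a \<in> A\<close>] by (intro coeff_eq_0) linarith
        thus ?thesis by (simp add: sum_nonneg)
      qed
    qed auto
    finally show "cmod (coeff r i) \<le> (\<Sum>a\<in>A. 1 * (\<Sum>j\<le>card A. cmod (coeff (L a) j)))" .
  qed
qed

text \<open>The interpolation bound leaves finitely many integers for each coefficient, and the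
  coefficient lists have length at most \<open>card A\<close>.\<close>

lemma finite_int_polys_bounded_values:
  fixes A :: "complex set"
  assumes "finite A"
  shows "finite {r. degree r < card A \<and> (\<forall>a\<in>A. cmod (poly (cpoly r) a) \<le> 1)}" (is "finite ?S")
proof -
  obtain B :: real where B: 
    "\<And>r i. degree r < card A \<Longrightarrow> (\<And>a. a \<in> A \<Longrightarrow> cmod (poly r a) \<le> 1) \<Longrightarrow> cmod (coeff r i) \<le> B"
    using coeff_bound_of_values[OF assms] by metis
  let ?I = "{- \<lceil>B\<rceil>..\<lceil>B\<rceil>}"
  have "coeffs ` ?S \<subseteq> {xs. set xs \<subseteq> ?I \<and> length xs \<le> card A}"
  proof clarify
    fix r :: "int poly" assume deg: "degree r < card A" and r: "\<forall>a\<in>A. cmod (poly (cpoly r) a) \<le> 1"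
    have *: "coeff r i \<in> ?I" for i
    proof -
      have "\<bar>real_of_int (coeff r i)\<bar> \<le> B"
        using B[of "cpoly r" i] deg r by (simp add: degree_cpoly coeff_map_poly)
      hence "real_of_int \<bar>coeff r i\<bar> \<le> of_int \<lceil>B\<rceil>" using le_of_int_ceiling[of B] by linarith
      hence "\<bar>coeff r i\<bar> \<le> \<lceil>B\<rceil>" by (simp only: of_int_le_iff)
      thus ?thesis by auto
    qed
    show "set (coeffs r) \<subseteq> ?I \<and> length (coeffs r) \<le> card A"
      using deg * by (auto simp: coeffs_def)
  qed
  hence "finite (coeffs ` ?S)" by (rule finite_subset) (intro finite_lists_length_le; simp)
  thus ?thesis by (rule finite_imageD) (simp add: inj_on_def coeffs_eq_iff)
qed

text \<open>Modulo \<open>P\<close> the powers of the variable are represented by polynomials that take values of modulus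
  at most 1 at the zeros of \<open>P\<close>. There are finitely many of these, so two powers agree modulo \<open>P\<close>.\<close>

lemma kronecker_cyclotomic:
  assumes irr: "irreducible P" and deg: "degree P > 0" and lc: "\<bar>lead_coeff P\<bar> = 1" and P0: "poly P 0 \<noteq> 0"
    and roots: "\<And>z. poly (cpoly P) z = 0 \<Longrightarrow> cmod z \<le> 1"
  shows "cyclotomic_poly P"
proof -
  define A where "A = {z. poly (cpoly P) z = 0}"
  have P: "P \<noteq> 0" using deg by auto
  hence "cpoly P \<noteq> 0" by (metis degree_0 degree_cpoly deg less_irrefl)
  hence finA: "finite A" unfolding A_def by (rule poly_roots_finite)
  have cardA: "card A = degree P" unfolding A_def by (rule card_roots_cpoly[OF irr])
  define S where "S = {r. degree r < card A \<and> (\<forall>a\<in>A. cmod (poly (cpoly r) a) \<le> 1)}"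
  have "\<exists>r\<in>S. P dvd monom 1 k - r" for k
  proof -
    obtain q r where qr: "pseudo_divmod (monom 1 k) P = (q, r)" by fastforce
    define c where "c = lead_coeff P ^ (Suc (degree (monom 1 k :: int poly)) - degree P)"
    \<comment> \<open>Since the leading coefficient is 1 or -1, so is \<open>c\<close>; multiplying
      by \<open>c\<close> once more turns pseudo-division into genuine division with
      remainder.\<close>
    have c: "c * c = 1" using lc unfolding c_def by (auto simp: abs_if power_mult_distrib[symmetric] split: if_splits)
    have eq: "smult c (monom 1 k) = P * q + r" and r: "r = 0 \<or> degree r < degree P"
      using pseudo_divmod[OF P qr] by (auto simp: c_def)
    have "monom 1 k = smult c (smult c (monom 1 k))" using c by simp
    hence eq': "monom 1 k = P * smult c q + smult c r" unfolding eq by (simp add: smult_add_right)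
    have "cmod (poly (cpoly (smult c r)) a) \<le> 1" if "a \<in> A" for a
    proof -
      have "poly (cpoly (smult c r)) a = poly (cpoly (monom 1 k)) a"
        using that unfolding eq' cpoly_add cpoly_mult by (simp add: A_def)
      also have "\<dots> = a ^ k" by (simp add: map_poly_monom poly_monom)
      finally show ?thesis using roots[of a] that by (simp add: A_def norm_power power_le_one)
    qed
    moreover have "degree (smult c r) < degree P" using r deg c by auto
    ultimately have "smult c r \<in> S" by (simp add: S_def cardA)
    moreover have "P dvd monom 1 k - smult c r" by (simp add: eq' dvd_smult)
    ultimately show ?thesis by blast
  qed
  then obtain f where f: "\<And>k. f k \<in> S" "\<And>k. P dvd monom 1 k - f k" by metis
  have "finite (range f)" using finite_int_polys_bounded_values[OF finA] f(1)
    unfolding S_def[symmetric] by (meson finite_subset image_subsetI)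
  hence "\<not> inj f" using finite_imageD by blast
  then obtain k l where "k < l" "f k = f l" unfolding inj_def by (metis linorder_neqE_nat)
  have "P dvd (monom 1 l - f l) - (monom 1 k - f k)" using f(2)[of l] f(2)[of k] by (rule dvd_diff)
  also have "(monom 1 l - f l) - (monom 1 k - f k) = monom 1 1 ^ k * (monom 1 (l - k) - 1)"
    using \<open>f k = f l\<close> \<open>k < l\<close> by (simp add: monom_power algebra_simps mult_monom)
  finally have "P dvd monom 1 1 ^ k * (monom 1 (l - k) - 1)" .
  \<comment> \<open>Otherwise \<open>P\<close> divides the variable itself. As \<open>P\<close> does
    not vanish at 0, the cofactor \<open>R\<close> does; by degrees \<open>R\<close> is constant,
    hence zero, which is impossible.\<close>
  moreover have "\<not> P dvd monom 1 1 ^ k"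
  proof
    assume *: "P dvd monom 1 1 ^ k"
    have "prime_elem P" using irr by (simp add: prime_elem_iff_irreducible)
    hence "P dvd monom 1 1" using * prime_elem_dvd_power by blast
    then obtain R where R: "monom 1 1 = P * R" ..
    have "poly (monom 1 1 :: int poly) 0 = 0" by (simp add: poly_monom)
    hence R0: "poly R 0 = 0" using P0 R by simp
    have "R \<noteq> 0" using R by (metis monom_eq_0_iff mult_zero_right one_neq_zero)
    moreover have "degree P + degree R = 1" using R P \<open>R \<noteq> 0\<close> by (metis degree_monom_eq degree_mult_eq one_neq_zero)
    ultimately have "degree R = 0" using deg by linarith
    then obtain c where "R = [:c:]" by (rule degree_eq_zeroE)
    with R0 \<open>R \<noteq> 0\<close> show False by simp
  qed
  ultimately have "P dvd monom 1 (l - k) - 1"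
    using irr prime_elem_dvd_multD by (metis prime_elem_iff_irreducible)
  with irr \<open>k < l\<close> show ?thesis unfolding cyclotomic_poly_def
    by (intro conjI exI[of _ "l - k"]) auto
qed


subsection \<open>Rotation invariance and logarithmic means\<close>

text \<open>Invariance of measure under orthogonal maps is applied in \<open>real^2\<close>; this
  identification carries it over to the complex plane.\<close>

lemma lborel_complex_eq_distr:
  "(lborel :: complex measure) = distr (lborel :: (real^2) measure) borel (\<lambda>v. Complex (v $ 1) (v $ 2))"
proof (rule lborel_eqI)
  fix l u :: complex
  assume le: "\<And>b. b \<in> Basis \<Longrightarrow> l \<bullet> b \<le> u \<bullet> b"
  let ?T = "\<lambda>v::real^2. Complex (v $ 1) (v $ 2)"
  let ?l = "vector [Re l, Im l] :: real^2" and ?u = "vector [Re u, Im u] :: real^2"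
  have T: "?T \<in> borel_measurable lborel"
    by (simp, intro borel_measurable_continuous_onI continuous_intros)
  have B: "(Basis :: (real^2) set) = {axis 1 1, axis 2 1}"
    by (auto simp: Basis_vec_def) (metis exhaust_2)
  have "?T -` box l u = box ?l ?u"
    by (auto simp: in_box_complex_iff mem_box_cart forall_2)
  hence "emeasure (distr lborel borel ?T) (box l u) = emeasure lborel (box ?l ?u)"
    using T by (subst emeasure_distr) auto
  also have "\<dots> = ennreal (\<Prod>b\<in>Basis. (?u - ?l) \<bullet> b)"
    using le[OF complex_Basis_1] le[OF complex_Basis_i]
    by (intro emeasure_lborel_box) (auto simp: B inner_axis)
  also have "(\<Prod>b\<in>Basis. (?u - ?l) \<bullet> b) = (\<Prod>b\<in>Basis. (u - l) \<bullet> b)"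
    by (simp add: B Basis_complex_def inner_axis axis_eq_axis)
  finally show "emeasure (distr lborel borel ?T) (box l u) = ennreal (\<Prod>b\<in>Basis. (u - l) \<bullet> b)" .
qed simp

text \<open>It suffices to compare measures of boxes. In real coordinates the preimage of a box
  under multiplication by \<open>c\<close> is its image under the orthogonal map \<open>?g\<close>,
  multiplication by \<open>cnj c\<close>, the inverse of \<open>c\<close>.\<close>

lemma distr_lborel_rotation:
  fixes c :: complex
  assumes c: "cmod c = 1"
  shows "distr lborel borel ((*) c) = lborel"
proof (rule lborel_eqI[symmetric])
  fix l u :: complex
  assume le: "\<And>b. b \<in> Basis \<Longrightarrow> l \<bullet> b \<le> u \<bullet> b"
  let ?T = "\<lambda>v::real^2. Complex (v $ 1) (v $ 2)"
  let ?U = "\<lambda>z. vector [Re z, Im z] :: real^2"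
  let ?g = "\<lambda>v. ?U (cnj c * ?T v)"
  have TU: "?T (?U z) = z" "?U (?T v) = v" for z v
    by (auto simp: vec_eq_iff forall_2)
  have T: "?T \<in> borel_measurable lborel"
    by (simp, intro borel_measurable_continuous_onI continuous_intros)
  have em: "emeasure lborel S = emeasure lborel (?T -` S)" if "S \<in> sets borel" for S
    using that T by (subst lborel_complex_eq_distr, subst emeasure_distr) auto
  have nU: "norm (?U z) = cmod z" for z
    by (simp add: norm_vec_def L2_set_def UNIV_2 cmod_def)
  have "norm (?g v) = norm v" for v
  proof -
    have "norm (?g v) = cmod (?T v)" unfolding nU by (simp add: norm_mult c)
    also have "\<dots> = norm (?U (?T v))" by (rule nU[symmetric])
    finally show ?thesis unfolding TU .
  qed
  moreover have "linear ?g"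
    by (intro linearI) (auto simp: vec_eq_iff forall_2 algebra_simps)
  ultimately have g: "orthogonal_transformation ?g"
    by (simp add: orthogonal_transformation)
  have cc: "c * cnj c = 1" using c by (metis complex_norm_square of_real_1 one_power2)
  hence cc': "cnj c * (c * z) = z" "c * (cnj c * z) = z" for z
    by (simp_all add: mult.assoc[symmetric]) (simp add: mult.commute)
  let ?B = "?T -` box l u" and ?S = "?T -` ((*) c -` box l u)"
  have S: "?S = ?g ` ?B"
  proof (intro equalityI subsetI)
    fix v assume "v \<in> ?S"
    hence "?U (c * ?T v) \<in> ?B" "v = ?g (?U (c * ?T v))"
      by (simp_all only: vimage_eq TU cc')
    thus "v \<in> ?g ` ?B" by blast
  next
    fix v assume "v \<in> ?g ` ?B"
    thus "v \<in> ?S" by (auto simp only: vimage_eq TU cc')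
  qed
  have box: "?B = box (?U l) (?U u)"
    by (auto simp: in_box_complex_iff mem_box_cart forall_2)
  have Bm: "?B \<in> lmeasurable" unfolding box by simp
  have mc: "(*) c \<in> borel_measurable lborel" by simp
  have Sb: "?S \<in> sets borel"
    using measurable_sets[OF T, of "(*) c -` box l u"] measurable_sets[OF mc, of "box l u"] by simp
  have "emeasure (distr lborel borel ((*) c)) (box l u) = emeasure lborel ((*) c -` box l u)"
    by (subst emeasure_distr) auto
  also have "\<dots> = emeasure lborel ?S"
    using measurable_sets[OF mc, of "box l u"] by (intro em) simp
  also have "\<dots> = emeasure lebesgue ?S" using Sb by simp
  also have "\<dots> = ennreal (measure lebesgue ?S)"
    unfolding S by (intro emeasure_eq_measure2 measurable_orthogonal_image g Bm)
  also have "measure lebesgue ?S = measure lebesgue ?B"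
    unfolding S by (intro measure_orthogonal_image g Bm)
  also have "ennreal \<dots> = emeasure lebesgue ?B" using Bm by (simp add: emeasure_eq_measure2)
  also have "\<dots> = emeasure lborel ?B" unfolding box by simp
  also have "\<dots> = emeasure lborel (box l u)" by (rule em[symmetric]) simp
  also have "\<dots> = ennreal (\<Prod>b\<in>Basis. (u - l) \<bullet> b)" using le by (rule emeasure_lborel_box)
  finally show "emeasure (distr lborel borel ((*) c)) (box l u) = ennreal (\<Prod>b\<in>Basis. (u - l) \<bullet> b)" .
qed simp

lemma set_integral_rotation:
  fixes f :: "complex \<Rightarrow> real"
  assumes c: "cmod c = 1" and S: "S \<in> sets borel" "\<And>z. c * z \<in> S \<longleftrightarrow> z \<in> S"
    and [measurable]: "f \<in> borel_measurable borel"
  shows "(LINT z:S|lborel. f (c * z)) = (LINT z:S|lborel. f z)"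
proof -
  note [measurable] = S(1)
  have "(LINT z:S|lborel. f z) = (LINT z:S|distr lborel borel ((*) c). f z)"
    by (simp add: distr_lborel_rotation[OF c])
  also have "\<dots> = (LINT z:S|lborel. f (c * z))"
    unfolding set_lebesgue_integral_def
    by (subst integral_distr) (auto simp: indicator_def S(2) intro!: Bochner_Integration.integral_cong)
  finally show ?thesis by simp
qed

section \<open>Vanishing of the mean of \<open>ln |1 - h|\<close>\<close>

lemma abs_ln_norm_one_minus_le:
  assumes "cmod w \<le> q" "q < 1"
  shows "\<bar>ln (cmod (1 - w))\<bar> \<le> - ln (1 - q)"
proof -
  have q0: "0 \<le> q" using assms norm_ge_zero order.trans by blast
  have l: "1 - q \<le> cmod (1 - w)" using norm_triangle_ineq2[of 1 w] assms by simp
  have u: "cmod (1 - w) \<le> 1 + q" using norm_triangle_ineq4[of 1 w] assms by simp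
  \<comment> \<open>This reduces the upper bound to the lower one: \<open>ln (1 + q)\<close> is at
    most \<open>- ln (1 - q)\<close>.\<close>
  have "(1 + q) * (1 - q) \<le> 1" by (simp add: algebra_simps)
  hence "1 + q \<le> 1 / (1 - q)" using assms by (simp add: field_simps)
  with u have "ln (cmod (1 - w)) \<le> ln (1 / (1 - q))" using l assms by (intro ln_mono) auto
  moreover have "ln (1 - q) \<le> ln (cmod (1 - w))" using l assms by (intro ln_mono) auto
  ultimately show ?thesis using assms by (simp add: ln_div)
qed

text \<open>Keeping \<open>h\<close> abstract lets one argument serve \<open>z / a\<close> on disks
  inside \<open>|z| < |a|\<close> and \<open>a / z\<close> on annuli outside; in both cases the
  rotation in \<open>rot\<close> is by the angle \<open>pi / m\<close>.\<close>

lemma mean_ln_norm_one_minus_eq_0: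
  fixes h :: "complex \<Rightarrow> complex"
  assumes S: "S \<in> sets borel" "emeasure lborel S < \<infinity>"
    and inv: "\<And>c z. cmod c = 1 \<Longrightarrow> c * z \<in> S \<longleftrightarrow> z \<in> S"
    and [measurable]: "h \<in> borel_measurable borel"
    and hq: "\<And>z. z \<in> S \<Longrightarrow> cmod (h z) \<le> q" and q: "q < 1"
    and rot: "\<And>m. m > 0 \<Longrightarrow> \<exists>c. cmod c = 1 \<and> (\<forall>z. h (c * z) ^ m = - (h z ^ m))"
  shows "(LINT z:S|lborel. ln (cmod (1 - h z))) = 0"
proof -
  note [measurable] = S(1)
  define F where "F m = (LINT z:S|lborel. ln (cmod (1 - h z ^ m)))" for m
  define C where "C = - ln (1 - q)"
  have pow: "cmod (h z ^ m) \<le> q" if "z \<in> S" "m > 0" for z m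
  proof -
    have "cmod (h z) \<le> 1" using hq[OF that(1)] q by linarith
    hence "cmod (h z) ^ m \<le> cmod (h z) ^ 1" using that by (intro power_decreasing) auto
    with hq[OF that(1)] show ?thesis by (simp add: norm_power)
  qed
  \<comment> \<open>The factor \<open>s\<close> is 1 or -1 below, for the two factors of
    \<open>1 - h^(2m)\<close>. The bound does not depend on \<open>m\<close>, which the final limit
    requires.\<close>
  have integrable: "set_integrable lborel S (\<lambda>z. ln (cmod (1 - s * h z ^ m)))"
    and bound: "\<bar>LINT z:S|lborel. ln (cmod (1 - s * h z ^ m))\<bar> \<le> C * measure lborel S"
    if "cmod s = 1" "m > 0" for s m
  proof -
    have b: "\<bar>ln (cmod (1 - s * h z ^ m))\<bar> \<le> C" if "z \<in> S" for z
      unfolding C_def using pow[OF \<open>z \<in> S\<close> \<open>m > 0\<close>] q \<open>cmod s = 1\<close>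
      by (intro abs_ln_norm_one_minus_le) (auto simp: norm_mult)
    have int: "set_integrable lborel S (\<lambda>z. C)"
      using S by (simp add: set_integrable_def)
    show i: "set_integrable lborel S (\<lambda>z. ln (cmod (1 - s * h z ^ m)))"
      by (rule set_integrable_bound[OF int]) (use b in \<open>auto simp: set_borel_measurable_def intro!: AE_I2 order.trans[OF _ abs_ge_self]\<close>)
    have "\<bar>LINT z:S|lborel. ln (cmod (1 - s * h z ^ m))\<bar> \<le> (LINT z:S|lborel. \<bar>ln (cmod (1 - s * h z ^ m))\<bar>)"
      using set_integral_norm_bound[OF i] by simp
    also have "\<dots> \<le> (LINT z:S|lborel. C)"
      using i int b by (intro set_integral_mono set_integrable_abs) auto
    also have "\<dots> = C * measure lborel S" by (simp add: set_lebesgue_integral_def)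
    finally show "\<bar>LINT z:S|lborel. ln (cmod (1 - s * h z ^ m))\<bar> \<le> C * measure lborel S" .
  qed
  have double: "F (2 * m) = 2 * F m" if m: "m > 0" for m
  proof -
    \<comment> \<open>The rotation turns \<open>1 - h^m\<close> into \<open>1 + h^m\<close> without
      changing the integral, so both factors of \<open>1 - h^(2m)\<close> contribute
      \<open>F m\<close>.\<close>
    obtain c where c: "cmod c = 1" "\<And>z. h (c * z) ^ m = - (h z ^ m)" using rot[OF m] by blast
    have "F m = (LINT z:S|lborel. ln (cmod (1 - h (c * z) ^ m)))"
      unfolding F_def using c inv
      by (intro set_integral_rotation[symmetric]) auto
    hence "2 * F m = (LINT z:S|lborel. ln (cmod (1 - 1 * h z ^ m))) + (LINT z:S|lborel. ln (cmod (1 - (-1) * h z ^ m)))"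
      by (simp add: F_def c)
    also have "\<dots> = (LINT z:S|lborel. ln (cmod (1 - 1 * h z ^ m)) + ln (cmod (1 - (-1) * h z ^ m)))"
      using m by (intro set_integral_add(2)[symmetric] integrable) auto
    also have "\<dots> = F (2 * m)" unfolding F_def
    proof (intro set_lebesgue_integral_cong allI impI)
      fix z assume "z \<in> S"
      let ?w = "h z ^ m"
      have "cmod ?w < 1" using pow[OF \<open>z \<in> S\<close> m] q by linarith
      hence ne: "1 - ?w \<noteq> 0" "1 + ?w \<noteq> 0" by (auto simp: add_eq_0_iff)
      have "1 - h z ^ (2 * m) = (1 - ?w) * (1 + ?w)"
        by (simp add: power_mult[of _ m 2, symmetric] mult.commute[of 2 m] algebra_simps power_even_eq power2_eq_square)
           (simp add: power_mult power2_eq_square)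
      thus "ln (cmod (1 - 1 * h z ^ m)) + ln (cmod (1 - (-1) * h z ^ m)) = ln (cmod (1 - h z ^ (2 * m)))"
        using ne by (simp add: norm_mult ln_mult)
    qed simp
    finally show ?thesis by simp
  qed
  have F1: "F 1 = F (2 ^ k) / 2 ^ k" for k
  proof (induction k)
    case (Suc k)
    thus ?case using double[of "2 ^ k"] by simp
  qed simp
  have "\<bar>F 1\<bar> \<le> C * measure lborel S * (1/2) ^ k" for k
  proof -
    have "\<bar>F (2 ^ k)\<bar> \<le> C * measure lborel S" using bound[of 1 "2 ^ k"] by (simp add: F_def)
    thus ?thesis unfolding F1[of k] by (simp add: power_divide divide_simps)
  qed
  moreover have "(\<lambda>k. C * measure lborel S * (1/2) ^ k) \<longlonglongrightarrow> C * measure lborel S * 0"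
    by (intro tendsto_intros) auto
  ultimately have "\<bar>F 1\<bar> \<le> C * measure lborel S * 0"
    using LIMSEQ_le_const by blast
  thus ?thesis by (simp add: F_def)
qed

lemma set_integrable_ln_norm:
  fixes a :: complex
  assumes S: "S \<in> sets borel" "bounded S"
  shows "set_integrable lborel S (\<lambda>z. ln (cmod (z - a)))"
proof -
  note [measurable] = S(1)
  obtain R where "R > 0" "S \<subseteq> ball a R" using bounded_subset_ballD[OF S(2), of a] by blast
  hence R: "\<And>z. z \<in> S \<Longrightarrow> cmod (z - a) \<le> R" "R > 0"
    by (auto simp: dist_norm norm_minus_commute subset_eq intro: less_imp_le)
  \<comment> \<open>The dyadic disks majorize the logarithmic singularity, since their areas decay geometrically.\<close>
  let ?D = "\<lambda>k. ball a ((1/2) ^ k)"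
  let ?g = "\<lambda>z. ennreal R * indicator S z + (\<Sum>k. ennreal (ln 2) * indicator (?D k) z)"
  have le: "ennreal (norm (indicator S z *\<^sub>R ln (cmod (z - a)))) \<le> ?g z" for z
  proof (cases "z \<in> S \<and> z \<noteq> a")
    \<comment> \<open>At \<open>z = a\<close> the convention \<open>ln 0 = 0\<close> makes the left
      side vanish.\<close>
    case False
    thus ?thesis by auto
  next
    case True
    define t where "t = cmod (z - a)"
    have t: "t > 0" "t \<le> R" using True R by (auto simp: t_def)
    show ?thesis
    proof (cases "t \<ge> 1")
      case True
      have "\<bar>ln t\<bar> \<le> R" using ln_bound[of t] t True by simp
      hence "ennreal \<bar>ln t\<bar> \<le> ennreal R" by (rule ennreal_leI)
      thus ?thesis using \<open>z \<in> S \<and> z \<noteq> a\<close> by (simp add: t_def[symmetric] add_increasing2)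
    next
      case False
      obtain n0 where "(1/2) ^ n0 < t" using real_arch_pow_inv[OF t(1), of "1/2"] by auto
      \<comment> \<open>With \<open>n\<close> minimal, \<open>z\<close> lies in the first
        \<open>n\<close> dyadic disks, while \<open>|ln t|\<close> is at most \<open>n\<close> times
        \<open>ln 2\<close>: each disk pays for one \<open>ln 2\<close>.\<close>
      define n where "n = (LEAST n. (1/2) ^ n \<le> t)"
      have n: "(1/2) ^ n \<le> t" unfolding n_def
        using LeastI[of "\<lambda>n. (1/2) ^ n \<le> t" n0] \<open>(1/2) ^ n0 < t\<close> by simp
      have n': "z \<in> ?D k" if "k < n" for k
        using not_less_Least[of k "\<lambda>n. (1/2) ^ n \<le> t"] that by (simp add: n_def t_def dist_norm norm_minus_commute)
      have "ln ((1/2) ^ n) \<le> ln t" using n t by (intro ln_mono) auto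
      hence "\<bar>ln t\<bar> \<le> real n * ln 2" using False t by (simp add: ln_realpow ln_div)
      hence "ennreal \<bar>ln t\<bar> \<le> ennreal (real n * ln 2)" by (rule ennreal_leI)
      also have "\<dots> = (\<Sum>k<n. ennreal (ln 2) * indicator (?D k) z)"
        using n' by (simp add: ennreal_mult ennreal_of_nat_eq_real_of_nat)
      also have "\<dots> \<le> (\<Sum>k. ennreal (ln 2) * indicator (?D k) z)"
        by (intro sum_le_suminf) auto
      finally show ?thesis using \<open>z \<in> S \<and> z \<noteq> a\<close> by (simp add: t_def[symmetric] add_increasing)
    qed
  qed
  have "(\<integral>\<^sup>+z. ennreal (norm (indicator S z *\<^sub>R ln (cmod (z - a)))) \<partial>lborel) \<le> (\<integral>\<^sup>+z. ?g z \<partial>lborel)"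
    by (intro nn_integral_mono le)
  also have "\<dots> = ennreal R * emeasure lborel S + (\<Sum>k. ennreal (ln 2) * emeasure lborel (?D k))"
  proof -
    have [measurable]: "(\<lambda>z. ennreal (ln 2) * indicator (?D k) z) \<in> borel_measurable lborel" for k
      by (intro borel_measurable_times_ennreal borel_measurable_indicator) simp_all
    have "(\<integral>\<^sup>+z. ?g z \<partial>lborel) = (\<integral>\<^sup>+z. ennreal R * indicator S z \<partial>lborel) +
        (\<integral>\<^sup>+z. (\<Sum>k. ennreal (ln 2) * indicator (?D k) z) \<partial>lborel)"
      by (rule nn_integral_add) measurable
    also have "(\<integral>\<^sup>+z. (\<Sum>k. ennreal (ln 2) * indicator (?D k) z) \<partial>lborel) =
        (\<Sum>k. \<integral>\<^sup>+z. ennreal (ln 2) * indicator (?D k) z \<partial>lborel)"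
      by (rule nn_integral_suminf) simp
    finally show ?thesis by (simp add: nn_integral_cmult_indicator del: ennreal_suminf_cmult)
  qed
  also have "(\<Sum>k. ennreal (ln 2) * emeasure lborel (?D k)) = (\<Sum>k. ennreal (ln 2 * pi * (1/4) ^ k))"
  proof (rule suminf_cong)
    fix k
    \<comment> \<open>The disk areas are \<open>pi / 4^k\<close>, so the majorant is a convergent
      geometric series.\<close>
    have "((1/2) ^ k)\<^sup>2 = (1/4 :: real) ^ k"
      by (simp add: power2_eq_square flip: power_mult_distrib)
    thus "ennreal (ln 2) * emeasure lborel (?D k) = ennreal (ln 2 * pi * (1/4) ^ k)"
      by (simp add: emeasure_ball unit_ball_vol_2 mult.assoc ennreal_mult)
  qed
  also have "ennreal R * emeasure lborel S + \<dots> < \<infinity>"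
  proof -
    have "emeasure lborel S < \<infinity>" using emeasure_bounded_finite[OF S(2)] .
    moreover have "summable (\<lambda>k. ln 2 * pi * (1/4::real) ^ k)" by (intro summable_mult summable_geometric) simp
    hence "(\<Sum>k. ennreal (ln 2 * pi * (1/4) ^ k)) \<noteq> \<infinity>"
      by (subst suminf_ennreal2) auto
    ultimately show ?thesis by (simp add: ennreal_mult_less_top less_top)
  qed
  finally show ?thesis unfolding set_integrable_def
    by (intro integrableI_bounded) auto
qed

lemma AE_lborel_notin_finite:
  assumes "finite (A :: complex set)"
  shows "AE z in lborel. z \<notin> A"
  by (rule AE_not_in) (use assms in \<open>rule finite_imp_null_set_lborel\<close>)

section \<open>Means of \<open>ln |z - a|\<close> over disks and annuli\<close>

lemma cis_power_eq_minus_1: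
  assumes "m > 0"
  shows "cis (pi / real m) ^ m = -1"
  using assms by (simp add: Complex.DeMoivre)

text \<open>Factor out \<open>a\<close>: the mean of \<open>ln |1 - z / a|\<close> vanishes because
  \<open>|z / a|\<close> stays below the ratio \<open>r / |a| < 1\<close>.\<close>

lemma LINT_ball_inner_ln_norm:
  fixes a :: complex
  assumes "0 < r" "r < cmod a"
  shows "(LINT z:ball 0 r|lborel. ln (cmod (z - a))) = pi * r\<^sup>2 * ln (cmod a)"
proof -
  have a: "a \<noteq> 0" using assms by auto
  have fin: "emeasure lborel (ball (0::complex) r) < \<infinity>" using assms by (simp add: emeasure_ball)
  have int: "set_integrable lborel (ball 0 r) (\<lambda>z. ln (cmod (z - a)))"
    by (intro set_integrable_ln_norm) auto
  have intc: "set_integrable lborel (ball (0::complex) r) (\<lambda>z. ln (cmod a))"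
    using fin by (simp add: set_integrable_def)
  have "0 = (LINT z:ball 0 r|lborel. ln (cmod (1 - z / a)))"
  proof (rule mean_ln_norm_one_minus_eq_0[symmetric])
    show "cmod (z / a) \<le> r / cmod a" if "z \<in> ball 0 r" for z
      using that assms by (simp add: norm_divide divide_right_mono)
    show "\<exists>c. cmod c = 1 \<and> (\<forall>z. (c * z / a) ^ m = - ((z / a) ^ m))" if "m > 0" for m
      by (rule exI[of _ "cis (pi / real m)"])
         (simp add: power_mult_distrib power_divide cis_power_eq_minus_1[OF that])
    show "r / cmod a < 1" using assms a by simp
  qed (use fin in \<open>auto simp: norm_mult\<close>)
  also have "\<dots> = (LINT z:ball 0 r|lborel. ln (cmod (z - a)) - ln (cmod a))"
  proof (intro set_lebesgue_integral_cong allI impI)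
    fix z :: complex assume "z \<in> ball 0 r"
    hence "z \<noteq> a" using assms by auto
    have "1 - z / a = - ((z - a) / a)" using a by (simp add: field_simps)
    thus "ln (cmod (1 - z / a)) = ln (cmod (z - a)) - ln (cmod a)"
      using a \<open>z \<noteq> a\<close> by (simp add: norm_divide ln_div)
  qed auto
  also have "\<dots> = (LINT z:ball 0 r|lborel. ln (cmod (z - a))) - (LINT z:ball (0::complex) r|lborel. ln (cmod a))"
    by (rule set_integral_diff(2)[OF int intc])
  also have "(LINT z:ball (0::complex) r|lborel. ln (cmod a)) = pi * r\<^sup>2 * ln (cmod a)"
    using assms by (simp add: set_lebesgue_integral_def content_ball unit_ball_vol_2)
  finally show ?thesis by simp
qed

text \<open>On the full disk the ratio has no bound below 1, so the disk is exhausted by smaller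
  concentric ones; integrability of the logarithm justifies the limit.\<close>

lemma LINT_ball_ln_norm:
  fixes a :: complex
  assumes "a \<noteq> 0"
  shows "(LINT z:ball 0 (cmod a)|lborel. ln (cmod (z - a))) = pi * (cmod a)\<^sup>2 * ln (cmod a)"
proof -
  \<comment> \<open>The offset 2 keeps \<open>r 0\<close> positive.\<close>
  define r where "r i = cmod a * (1 - 1 / real (i + 2))" for i
  have r: "0 < r i" "r i < cmod a" for i
    using assms mult_strict_left_mono[of "1 - 1 / real (i + 2)" 1 "cmod a"] by (simp_all add: r_def)
  have r_lim: "r \<longlonglongrightarrow> cmod a" unfolding r_def by real_asymp
  have "incseq r" unfolding r_def incseq_def
    by (auto intro!: mult_left_mono divide_left_mono)
  hence inc: "incseq (\<lambda>i. ball (0::complex) (r i))" by (force simp: incseq_def intro: less_le_trans)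
  have un: "(\<Union>i. ball (0::complex) (r i)) = ball 0 (cmod a)"
  proof (intro equalityI subsetI)
    fix z :: complex assume "z \<in> ball 0 (cmod a)"
    hence "\<forall>\<^sub>F i in sequentially. cmod z < r i" using order_tendstoD(1)[OF r_lim] by simp
    thus "z \<in> (\<Union>i. ball 0 (r i))" by (auto simp: eventually_sequentially)
  next
    fix z :: complex assume "z \<in> (\<Union>i. ball 0 (r i))"
    thus "z \<in> ball 0 (cmod a)" using r(2) by (auto intro: less_trans)
  qed
  have "(\<lambda>i. LINT z:ball 0 (r i)|lborel. ln (cmod (z - a)))
      \<longlonglongrightarrow> (LINT z:(\<Union>i. ball 0 (r i))|lborel. ln (cmod (z - a)))"
    by (intro set_integral_cont_up inc) (auto simp: un intro!: set_integrable_ln_norm)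
  moreover have "(\<lambda>i. LINT z:ball 0 (r i)|lborel. ln (cmod (z - a))) \<longlonglongrightarrow> pi * (cmod a)\<^sup>2 * ln (cmod a)"
    unfolding LINT_ball_inner_ln_norm[OF r] by (intro tendsto_intros r_lim)
  ultimately show ?thesis unfolding un using LIMSEQ_unique by blast
qed

lemma LINT_inner_annulus_ln_norm:
  fixes a :: complex
  assumes "cmod a < s"
  shows "(LINT z:ball 0 1 - cball 0 s|lborel. ln (cmod (z - a))) = (LINT z:ball 0 1 - cball 0 s|lborel. ln (cmod z))"
    (is "(LINT z:?S|lborel. _) = _")
proof -
  have s: "s > 0" using assms by (meson le_less_trans norm_ge_zero)
  have int: "set_integrable lborel ?S (\<lambda>z. ln (cmod (z - b)))" for b
    by (intro set_integrable_ln_norm) (auto intro: bounded_subset[OF bounded_ball])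
  have "0 = (LINT z:?S|lborel. ln (cmod (1 - a / z)))"
  proof (rule mean_ln_norm_one_minus_eq_0[symmetric])
    show "cmod (a / z) \<le> cmod a / s" if "z \<in> ?S" for z
      using that s by (simp add: norm_divide frac_le)
    \<comment> \<open>At \<open>z = 0\<close> both sides are 0, because division by 0 gives 0 and
      \<open>m > 0\<close>.\<close>
    show "\<exists>c. cmod c = 1 \<and> (\<forall>z. (a / (c * z)) ^ m = - ((a / z) ^ m))" if "m > 0" for m
      using cis_power_eq_minus_1[OF that] by (intro exI[of _ "cis (pi / real m)"])
         (simp add: power_mult_distrib power_divide)
    show "emeasure lborel ?S < \<infinity>"
      by (intro emeasure_bounded_finite bounded_subset[OF bounded_ball]) auto
  qed (use assms s in \<open>auto simp: norm_mult\<close>)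
  also have "\<dots> = (LINT z:?S|lborel. ln (cmod (z - a)) - ln (cmod (z - 0)))"
  proof (intro set_lebesgue_integral_cong allI impI)
    fix z assume "z \<in> ?S"
    hence "z \<noteq> a" "z \<noteq> 0" using assms s by auto
    moreover have "1 - a / z = (z - a) / z" using \<open>z \<noteq> 0\<close> by (simp add: field_simps)
    ultimately show "ln (cmod (1 - a / z)) = ln (cmod (z - a)) - ln (cmod (z - 0))"
      by (simp add: norm_divide ln_div)
  qed auto
  also have "\<dots> = (LINT z:?S|lborel. ln (cmod (z - a))) - (LINT z:?S|lborel. ln (cmod (z - 0)))"
    by (rule set_integral_diff(2)[OF int int])
  finally show ?thesis by simp
qed

text \<open>Limit of the previous identity along annuli whose inner radii decrease to
  \<open>|a|\<close>; those with inner radius at least 1 are merely empty.\<close>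

lemma LINT_annulus_ln_norm:
  fixes a :: complex
  assumes "a \<noteq> 0"
  shows "(LINT z:ball 0 1 - cball 0 (cmod a)|lborel. ln (cmod (z - a))) =
         (LINT z:ball 0 1 - cball 0 (cmod a)|lborel. ln (cmod z))"
proof -
  define r where "r i = cmod a * (1 + 1 / real (i + 1))" for i
  have r: "cmod a < r i" for i using assms by (simp add: r_def field_simps)
  have r_lim: "r \<longlonglongrightarrow> cmod a" unfolding r_def by real_asymp
  have "decseq r" unfolding r_def decseq_def
    by (auto intro!: mult_left_mono divide_left_mono)
  let ?S = "\<lambda>i. ball (0::complex) 1 - cball 0 (r i)"
  have inc: "incseq ?S" using \<open>decseq r\<close> by (fastforce simp: incseq_def decseq_def)
  have un: "(\<Union>i. ?S i) = ball 0 1 - cball 0 (cmod a)"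
  proof (intro equalityI subsetI)
    fix z :: complex assume z: "z \<in> ball 0 1 - cball 0 (cmod a)"
    hence "\<forall>\<^sub>F i in sequentially. r i < cmod z" using order_tendstoD(2)[OF r_lim] by simp
    thus "z \<in> (\<Union>i. ?S i)" using z by (auto simp: eventually_sequentially not_le)
  next
    fix z :: complex assume "z \<in> (\<Union>i. ?S i)"
    thus "z \<in> ball 0 1 - cball 0 (cmod a)" using r by (auto simp: not_le intro: less_trans)
  qed
  have lim: "(\<lambda>i. LINT z:?S i|lborel. ln (cmod (z - b))) \<longlonglongrightarrow> (LINT z:(\<Union>i. ?S i)|lborel. ln (cmod (z - b)))" for b
    by (intro set_integral_cont_up inc)
       (auto simp: un intro!: set_integrable_ln_norm bounded_subset[OF bounded_ball])
  have "(\<lambda>i. LINT z:?S i|lborel. ln (cmod (z - a))) \<longlonglongrightarrow> (LINT z:(\<Union>i. ?S i)|lborel. ln (cmod (z - 0)))"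
    using lim[of 0] unfolding LINT_inner_annulus_ln_norm[OF r] by simp
  from LIMSEQ_unique[OF lim this] show ?thesis unfolding un by simp
qed

lemma LINT_unit_disk_ln_norm_unimodular:
  fixes a :: complex
  assumes "cmod a = 1"
  shows "(LINT z:ball 0 1|lborel. ln (cmod (z - a))) = 0"
  using LINT_ball_ln_norm[of a] assms by fastforce

text \<open>Write \<open>\<rho> = |a|\<close> and split the disk at this radius. The inner disk
  contributes exactly \<open>pi * \<rho>^2 * ln \<rho>\<close>. On the annulus, of area
  \<open>pi * (1 - \<rho>^2)\<close>, the integrand may be replaced by \<open>ln |z|\<close>, which
  exceeds \<open>ln \<rho>\<close>.\<close>

lemma LINT_unit_disk_ln_norm_gt:
  fixes a :: complex
  assumes a: "a \<noteq> 0" "cmod a < 1"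
  shows "(LINT z:ball 0 1|lborel. ln (cmod (z - a))) > pi * ln (cmod a)"
proof -
  let ?\<rho> = "cmod a"
  let ?D = "ball (0::complex) ?\<rho>" and ?C = "cball (0::complex) ?\<rho>"
  let ?A = "ball 0 1 - ?C"
  have int: "set_integrable lborel S (\<lambda>z. ln (cmod (z - b)))" if "S \<in> sets borel" "bounded S" for S b
    using that by (rule set_integrable_ln_norm)
  have meas_ln: "set_borel_measurable lborel S (\<lambda>z. ln (cmod (z - a)))"
    if "S \<in> sets borel" "bounded S" for S
    using int[OF that, of a] unfolding set_integrable_def set_borel_measurable_def
    by (rule borel_measurable_integrable)
  have bA: "bounded ?A" by (intro bounded_subset[OF bounded_ball]) auto
  have "ball 0 1 = ?C \<union> ?A" using a by auto
  hence "(LINT z:ball 0 1|lborel. ln (cmod (z - a))) = (LINT z:?C \<union> ?A|lborel. ln (cmod (z - a)))"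
    by simp
  also have "\<dots> = (LINT z:?C|lborel. ln (cmod (z - a))) + (LINT z:?A|lborel. ln (cmod (z - a)))"
    by (rule set_integral_Un) (use bA in \<open>auto intro!: int\<close>)
  also have "(LINT z:?C|lborel. ln (cmod (z - a))) = (LINT z:?D|lborel. ln (cmod (z - a)))"
  proof (rule set_integral_cong_set)
    have "sphere (0::complex) ?\<rho> \<in> null_sets lborel"
      using negligible_sphere[of "0::complex" ?\<rho>] by (simp add: negligible_iff_null_sets null_sets_completion_iff)
    hence "AE z in lborel. z \<notin> sphere (0::complex) ?\<rho>" by (rule AE_not_in)
    thus "AE z in lborel. (z \<in> ?D) = (z \<in> ?C)" by eventually_elim auto
  qed (auto intro!: meas_ln)
  also have "\<dots> = pi * ?\<rho>\<^sup>2 * ln ?\<rho>" by (rule LINT_ball_ln_norm[OF a(1)])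
  also have "(LINT z:?A|lborel. ln (cmod (z - a))) = (LINT z:?A|lborel. ln (cmod z))"
    by (rule LINT_annulus_ln_norm[OF a(1)])
  finally have eq: "(LINT z:ball 0 1|lborel. ln (cmod (z - a))) = pi * ?\<rho>\<^sup>2 * ln ?\<rho> + (LINT z:?A|lborel. ln (cmod z))" .
  have meas: "measure lborel ?A = pi * (1 - ?\<rho>\<^sup>2)"
  proof -
    have "measure lborel ?A = measure lborel (ball (0::complex) 1) - measure lborel ?C"
      by (rule measure_Diff) (use a emeasure_lborel_ball_finite[of "0::complex" 1] in auto)
    thus ?thesis by (simp add: content_ball content_cball unit_ball_vol_2 algebra_simps)
  qed
  have \<rho>2: "?\<rho>\<^sup>2 < 1" using a by (simp add: power_less_one_iff)
  have intc: "set_integrable lborel ?A (\<lambda>z. ln ?\<rho>)"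
    using emeasure_bounded_finite[OF bA] by (simp add: set_integrable_def)
  have int0: "set_integrable lborel ?A (\<lambda>z. ln (cmod z))" using int[of ?A 0] bA by simp
  have "pi * (1 - ?\<rho>\<^sup>2) * ln ?\<rho> = (LINT z:?A|lborel. ln ?\<rho>)"
    by (simp add: set_lebesgue_integral_def meas)
  also have "\<dots> < (LINT z:?A|lborel. ln (cmod z))"
  proof -
    let ?f = "\<lambda>z. indicator ?A z *\<^sub>R (ln (cmod z) - ln ?\<rho>)"
    have i: "integrable lborel ?f"
      using set_integral_diff(1)[OF int0 intc] by (simp add: set_integrable_def)
    have pos: "ln (cmod z) - ln ?\<rho> > 0" if "z \<in> ?A" for z
      using that a ln_less_cancel_iff[of "cmod a" "cmod z"] by (cases "z = 0") (auto simp: not_le)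
    \<comment> \<open>Strictness: \<open>?f\<close> is positive on the annulus, which has positive
      area.\<close>
    have "\<not> (AE z in lborel. ?f z = 0)"
    proof
      assume "AE z in lborel. ?f z = 0"
      hence "AE z in lborel. z \<notin> ?A" by eventually_elim (use pos in \<open>fastforce simp: indicator_def\<close>)
      hence "?A \<in> null_sets lborel" by (subst (asm) AE_iff_null_sets[symmetric]) auto
      hence "measure lborel ?A = 0" by (simp add: measure_eq_0_null_sets)
      thus False using meas \<rho>2 by simp
    qed
    moreover have nn: "AE z in lborel. 0 \<le> ?f z"
      using pos by (intro AE_I2) (force simp: indicator_def intro: less_imp_le)
    ultimately have "integral\<^sup>L lborel ?f \<noteq> 0" using integral_nonneg_eq_0_iff_AE[OF i nn] by blast
    hence "integral\<^sup>L lborel ?f > 0" using integral_nonneg_AE[OF nn] by linarith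
    also have "integral\<^sup>L lborel ?f = (LINT z:?A|lborel. ln (cmod z)) - (LINT z:?A|lborel. ln ?\<rho>)"
      using set_integral_diff(2)[OF int0 intc] by (simp add: set_lebesgue_integral_def)
    finally show ?thesis by simp
  qed
  finally show ?thesis unfolding eq by (simp add: algebra_simps)
qed

subsection \<open>The norm of a polynomial in terms of its zeros\<close>

text \<open>Squarefreeness allows a product over the set of zeros, without multiplicities; the
  logarithm turns it into a sum of means.\<close>

lemma ln_norm0:
  fixes p :: "complex poly"
  assumes "rsquarefree p"
  shows "ln (norm0 p) = ln (cmod (lead_coeff p)) +
           (\<Sum>a | poly p a = 0. (LINT z:ball 0 1|lborel. ln (cmod (z - a))) / pi)"
proof -
  let ?A = "{a. poly p a = 0}" and ?D = "ball (0::complex) 1"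
  have p: "p \<noteq> 0" using assms by (auto simp: rsquarefree_def)
  have fin: "finite ?A" using p by (rule poly_roots_finite)
  have val: "poly p z = lead_coeff p * (\<Prod>a\<in>?A. z - a)" for z
    by (subst complex_poly_decompose_rsquarefree[OF assms, symmetric]) (simp add: poly_prod)
  have eq: "ln (cmod (poly p z)) = ln (cmod (lead_coeff p)) + (\<Sum>a\<in>?A. ln (cmod (z - a)))"
    if "z \<notin> ?A" for z
  proof -
    have "ln (cmod (poly p z)) = ln (cmod (lead_coeff p)) + ln (\<Prod>a\<in>?A. cmod (z - a))"
      using that p fin by (subst val) (simp add: norm_mult ln_mult flip: prod_norm)
    also have "ln (\<Prod>a\<in>?A. cmod (z - a)) = (\<Sum>a\<in>?A. ln (cmod (z - a)))"
      using that fin by (intro ln_prod) auto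
    finally show ?thesis .
  qed
  have int: "set_integrable lborel ?D (\<lambda>z. ln (cmod (z - a)))" for a
    by (intro set_integrable_ln_norm) auto
  have intc: "set_integrable lborel ?D (\<lambda>z. ln (cmod (lead_coeff p)))"
    using emeasure_lborel_ball_finite[of "0::complex" 1] by (simp add: set_integrable_def)
  have [measurable]: "(\<lambda>z. poly p z) \<in> borel_measurable borel"
    by (intro borel_measurable_continuous_onI continuous_intros)
  have "(LINT z:?D|lborel. ln (cmod (poly p z))) =
      (LINT z:?D|lborel. ln (cmod (lead_coeff p)) + (\<Sum>a\<in>?A. ln (cmod (z - a))))"
  \<comment> \<open>The pointwise identity can fail at the zeros, where \<open>ln 0 = 0\<close>;
    they form a null set.\<close>
  proof (rule set_lebesgue_integral_cong_AE)
    show "AE z\<in>?D in lborel. ln (cmod (poly p z)) = ln (cmod (lead_coeff p)) + (\<Sum>a\<in>?A. ln (cmod (z - a)))"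
      using AE_lborel_notin_finite[OF fin] by eventually_elim (use eq in blast)
  qed auto
  also have "\<dots> = (LINT z:?D|lborel. ln (cmod (lead_coeff p))) + (LINT z:?D|lborel. (\<Sum>a\<in>?A. ln (cmod (z - a))))"
    by (intro set_integral_add(2) intc) (use int in \<open>auto simp: set_integrable_def sum_distrib_left\<close>)
  also have "(LINT z:?D|lborel. (\<Sum>a\<in>?A. ln (cmod (z - a)))) = (\<Sum>a\<in>?A. LINT z:?D|lborel. ln (cmod (z - a)))"
    using int by (simp add: set_lebesgue_integral_def set_integrable_def sum_distrib_left)
  also have "(LINT z:?D|lborel. ln (cmod (lead_coeff p))) = pi * ln (cmod (lead_coeff p))"
    by (simp add: set_lebesgue_integral_def content_ball unit_ball_vol_2)
  finally show ?thesis
    by (simp add: norm0_def add_divide_distrib sum_divide_distrib)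
qed

section \<open>The two implications\<close>

lemma lead_coeff_cpoly: "lead_coeff (cpoly p) = of_int (lead_coeff p)"
  by (simp add: degree_cpoly coeff_map_poly)

text \<open>All zeros are roots of unity, so every mean is 0, and the leading coefficient divides
  that of the monic \<open>z^m - 1\<close>, so it is 1 or -1.\<close>

lemma cyclotomic_poly_imp_norm0_eq_1:
  assumes "cyclotomic_poly P"
  shows "norm0 (cpoly P) = 1"
proof -
  obtain m where irr: "irreducible P" and m: "m \<ge> 1" "P dvd monom 1 m - 1"
    using assms by (auto simp: cyclotomic_poly_def)
  obtain Q where Q: "monom 1 m - 1 = P * Q" using m(2) ..
  have root: "cmod a = 1" if "poly (cpoly P) a = 0" for a
  proof -
    have "poly (cpoly (monom 1 m - 1)) a = 0" unfolding Q cpoly_mult using that by simp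
    hence "a ^ m = 1" by (simp add: cpoly_diff map_poly_monom poly_monom)
    hence "cmod a ^ m = 1" by (metis norm_one norm_power)
    thus ?thesis using m(1) power_eq_imp_eq_base[of "cmod a" m 1] by simp
  qed
  have "lead_coeff (monom 1 m - 1 :: int poly) = 1"
  proof -
    have "degree (monom 1 m - 1 :: int poly) = m"
      using degree_add_eq_left[of "-1" "monom 1 m :: int poly"] m(1) by (simp add: degree_monom_eq)
    thus ?thesis using m(1) by simp
  qed
  hence "lead_coeff P * lead_coeff Q = 1" unfolding Q lead_coeff_mult .
  hence "\<bar>lead_coeff P\<bar> = 1" using abs_zmult_eq_1[of "lead_coeff P" "lead_coeff Q"] by simp
  hence "cmod (lead_coeff (cpoly P)) = 1" unfolding lead_coeff_cpoly by simp
  hence "ln (norm0 (cpoly P)) = 0"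
    unfolding ln_norm0[OF rsquarefree_cpoly[OF irr]]
    by (simp add: LINT_unit_disk_ln_norm_unimodular root)
  thus ?thesis by (simp add: norm0_def)
qed

lemma norm0_eq_1_imp_abs_lead_coeff_eq_1:
  fixes P :: "int poly"
  assumes sqf: "rsquarefree (cpoly P)" and P0: "poly P 0 \<noteq> 0" and norm: "norm0 (cpoly P) = 1"
    and roots: "\<And>z. poly (cpoly P) z = 0 \<Longrightarrow> cmod z \<le> 1"
  shows "\<bar>lead_coeff P\<bar> = 1"
proof -
  let ?A = "{a. poly (cpoly P) a = 0}"
  define I where "I a = (LINT z:ball 0 1|lborel. ln (cmod (z - a))) / pi" for a :: complex
  have "cpoly P \<noteq> 0" using sqf by (auto simp: rsquarefree_def)
  hence fin: "finite ?A" and lc: "lead_coeff (cpoly P) \<noteq> 0" by (auto intro: poly_roots_finite)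
  have poly0: "poly (cpoly P) 0 = of_int (poly P 0)"
    by (simp add: poly_0_coeff_0 coeff_map_poly)
  have nz: "a \<noteq> 0" if "a \<in> ?A" for a using that P0 poly0 by auto
  \<comment> \<open>Integrality enters here: \<open>P(0)\<close> is a nonzero integer.\<close>
  have "1 \<le> cmod (poly (cpoly P) 0)" using P0 by (simp add: poly0)
  also have "poly (cpoly P) 0 = lead_coeff (cpoly P) * (\<Prod>a\<in>?A. - a)"
    by (subst complex_poly_decompose_rsquarefree[OF sqf, symmetric]) (simp add: poly_prod)
  finally have "1 \<le> cmod (lead_coeff (cpoly P)) * (\<Prod>a\<in>?A. cmod a)"
    by (simp add: norm_mult prod_norm[symmetric])
  hence "0 \<le> ln (cmod (lead_coeff (cpoly P)) * (\<Prod>a\<in>?A. cmod a))" by simp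
  also have "\<dots> = ln (cmod (lead_coeff (cpoly P))) + ln (\<Prod>a\<in>?A. cmod a)"
    using lc nz fin by (subst ln_mult) auto
  also have "ln (\<Prod>a\<in>?A. cmod a) = (\<Sum>a\<in>?A. ln (cmod a))"
    using nz fin by (intro ln_prod) auto
  finally have 1: "0 \<le> ln (cmod (lead_coeff (cpoly P))) + (\<Sum>a\<in>?A. ln (cmod a))" .
  have 2: "0 = ln (cmod (lead_coeff (cpoly P))) + (\<Sum>a\<in>?A. I a)"
    using ln_norm0[OF sqf] norm by (simp add: I_def)
  have I_gt: "ln (cmod a) < I a" if "a \<in> ?A" "cmod a \<noteq> 1" for a
    using LINT_unit_disk_ln_norm_gt[of a] nz[OF that(1)] roots[of a] that
    by (simp add: I_def field_simps)
  have I_1: "I a = 0" if "cmod a = 1" for a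
    using that by (simp add: I_def LINT_unit_disk_ln_norm_unimodular)
  have I_ge: "ln (cmod a) \<le> I a" if "a \<in> ?A" for a
    using I_gt[OF that] I_1 by (cases "cmod a = 1") auto
  have all1: "cmod a = 1" if "a \<in> ?A" for a
  proof (rule ccontr)
    assume "cmod a \<noteq> 1"
    \<comment> \<open>A single zero off the unit circle makes the inequality between the sums
      strict, contradicting facts \<open>1\<close> and \<open>2\<close>.\<close>
    hence "(\<Sum>a\<in>?A. ln (cmod a)) < (\<Sum>a\<in>?A. I a)"
      using I_gt I_ge that by (intro sum_strict_mono_ex1 fin) blast+
    with 1 2 show False by linarith
  qed
  have "(\<Sum>a\<in>?A. I a) = 0" using all1 I_1 by (intro sum.neutral) blast
  hence "cmod (lead_coeff (cpoly P)) = 1" using 2 lc by simp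
  thus ?thesis unfolding lead_coeff_cpoly norm_of_int by simp
qed

theorem theorem1p3:
  fixes P :: "int poly" and n :: nat
  assumes "irreducible P"
    and "degree P \<le> n"
    and "poly P 0 \<noteq> 0"
    and "\<And>z::complex. poly (map_poly of_int P) z = 0 \<Longrightarrow> cmod z \<le> 1"
  shows "cyclotomic_poly P \<longleftrightarrow> norm0 (map_poly of_int P) = 1"
proof
  assume norm: "norm0 (cpoly P) = 1"
  have lc: "\<bar>lead_coeff P\<bar> = 1"
    using norm0_eq_1_imp_abs_lead_coeff_eq_1[OF rsquarefree_cpoly] assms norm by blast
  \<comment> \<open>A constant with leading coefficient 1 or -1 is a unit, which irreducibility
    excludes.\<close>
  have "degree P > 0"
  proof (rule ccontr)
    assume "\<not> degree P > 0"
    then obtain c where c: "P = [:c:]" by (auto elim: degree_eq_zeroE)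
    hence "is_unit P" using lc by (simp add: is_unit_const_poly_iff)
    thus False using assms(1) by (simp add: irreducible_def)
  qed
  thus "cyclotomic_poly P" using kronecker_cyclotomic assms lc by blast
qed (rule cyclotomic_poly_imp_norm0_eq_1)

end
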